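(* Let $n\geq 3$ and let $\ell$ be an integer with $\sqrt{2n\log(2n)} \leq \ell \leq n$. If $G$ and $G'$ are graphs on $n$ vertices with $\mathcal{D}_\ell(G)=\mathcal{D}_\ell(G')$, then $G$ and $G'$ have the same degree sequence (the same multiset of vertex degrees).
   Context: All graphs are finite, simple and undirected; $\log$ denotes the natural logarithm. For a graph $G$ and an integer $\ell$, the $\ell$-deck $\mathcal{D}_\ell(G)$ is the multiset of isomorphism classes of all induced subgraphs of $G$ on exactly $\ell$ vertices (one for each $\ell$-subset of $V(G)$). *)

theory Defs
  imports Complex_Main "HOL-Library.Multiset" "Graph_Theory.Graph_Theory"
begin

text \<open>
  Finite simple undirected graphs are the \<open>pair_graph\<close>s of the session Graph_Theory: finite
  vertex set, and a symmetric irreflexive arc relation in which an edge \<open>{u, v}\<close> is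
  represented by the two arcs \<open>(u, v)\<close> and \<open>(v, u)\<close>.

  The isomorphism class of a finite graph is taken among the graphs with vertices in \<open>nat\<close>, so that
  classes of graphs over different vertex types can be compared. Every finite graph has an
  isomorphic copy there, hence two finite graphs have the same class iff they are isomorphic;
  see \<open>iso_class_eq_iff\<close> and \<open>induced_subgraph_pair_graph\<close> below.
\<close>

definition iso_class :: "('a, 'a \<times> 'a) pre_digraph \<Rightarrow> nat pair_pre_digraph set" where
  "iso_class G = {H. digraph_iso G (with_proj H)}"

definition deck :: "nat \<Rightarrow> 'a pair_pre_digraph \<Rightarrow> nat pair_pre_digraph set multiset" where
  "deck l G =
     image_mset (\<lambda>S. iso_class (with_proj G \<restriction> S)) (mset_set {S. S \<subseteq> pverts G \<and> card S = l})"

text \<open>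
  By symmetry of the arc relation, the out-degree of a vertex is its number of neighbours.
\<close>

definition degree_sequence :: "'a pair_pre_digraph \<Rightarrow> nat multiset" where
  "degree_sequence G = image_mset (out_degree (with_proj G)) (mset_set (pverts G))"

lemma ex_nat_copy:
  assumes "pair_graph G"
  shows "\<exists>H :: nat pair_pre_digraph. digraph_iso (with_proj G) (with_proj H)"
proof -
  interpret pair_graph G by fact
  obtain f :: "'a \<Rightarrow> nat" where f: "inj_on f (pverts G)"
    using finite_imp_inj_to_nat_seg[OF pair_finite_verts] by metis
  define h where "h = \<lparr>iso_verts = f, iso_arcs = map_prod f f, iso_head = snd, iso_tail = fst\<rparr>"
  have "inj_on (map_prod f f) (parcs G)"
    by (rule inj_on_subset[OF map_prod_inj_on[OF f f]]) (auto dest: in_arcsD1 in_arcsD2)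
  then have "digraph_isomorphism h"
    using f by (auto simp: digraph_isomorphism_def h_def wf_digraph)
  moreover have "app_iso h (with_proj G) =
      with_proj \<lparr>pverts = f ` pverts G, parcs = map_prod f f ` parcs G\<rparr>"
    by (simp add: app_iso_def h_def with_proj_def)
  ultimately show ?thesis
    unfolding digraph_iso_def by metis
qed

lemma iso_class_eq_iff:
  assumes "pair_graph G" "pair_graph H"
  shows "iso_class (with_proj G) = iso_class (with_proj H) \<longleftrightarrow>
         digraph_iso (with_proj G) (with_proj H)"
proof -
  interpret G: pair_graph G by fact
  interpret H: pair_graph H by fact
  show ?thesis
    using ex_nat_copy[OF assms(1)] digraph_iso_swap[OF G.wf_digraph] digraph_iso_swap[OF H.wf_digraph]
    unfolding iso_class_def by (blast intro: digraph_iso_trans)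
qed

lemma induced_subgraph_pair_graph:
  assumes "pair_graph G" "S \<subseteq> pverts G"
  shows "\<exists>H. pair_graph H \<and> with_proj G \<restriction> S = with_proj H"
proof -
  interpret pair_graph G by fact
  let ?H = "\<lparr>pverts = S, parcs = {e \<in> parcs G. fst e \<in> S \<and> snd e \<in> S}\<rparr>"
  have "pair_graph ?H"
    using pair_finite_verts pair_finite_arcs pair_no_loops pair_sym_arcs assms(2)
    by unfold_locales (auto simp: symmetric_def sym_def finite_subset)
  moreover have "with_proj G \<restriction> S = with_proj ?H"
    by (simp add: induce_subgraph_def with_proj_def)
  ultimately show ?thesis by blast
qed

end

theory Submission
  imports Defs "HOL-Computational_Algebra.Polynomial" "HOL-Analysis.Convex"
begin

text \<open>
  Counting triples \<open>(v, A, S)\<close>, where \<open>S\<close> is a card containing \<open>v\<close> and a set \<open>A\<close> of \<open>s\<close> neighbours of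
  \<open>v\<close>, shows that the \<open>l\<close>-deck determines \<open>\<Sum>v. deg v choose s\<close> for all \<open>s < l\<close>. Hence the
  difference \<open>b\<close> of the degree distributions of the two graphs is orthogonal to all polynomials of
  degree less than \<open>l\<close>. Suppose \<open>b \<noteq> 0\<close>, shift its first nonzero entry to position \<open>0\<close>, and let
  \<open>N = n - 1\<close>. If \<open>l \<le> N\<close>, some polynomial \<open>r\<close> of degree less than \<open>l\<close> satisfies
  \<open>(\<Sum>j=1..N. r j * q j) = q 0\<close> for all polynomials \<open>q\<close> of degree less than \<open>l\<close>, and
  \<open>r 0 + 1 = (N + l choose l) / (N choose l) \<ge> exp (l\<^sup>2 / (N + 1/2))\<close>, which is at least \<open>4 n\<^sup>2\<close>.
  Testing \<open>b\<close> against \<open>r\<close>, the Cauchy-Schwarz inequality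
  gives \<open>4 n\<^sup>2 - 1 \<le> (b 0)\<^sup>2 * r 0 \<le> (\<Sum>j. (b j)\<^sup>2) \<le> 2 n\<^sup>2\<close>, a contradiction. If \<open>l = n\<close>,
  the product of the \<open>x - j\<close> with \<open>1 \<le> j \<le> N\<close> isolates \<open>b 0\<close>.
\<close>

subsection \<open>Polynomials and binomial coefficients\<close>

text \<open>Subtracting the multiple of \<open>B (degree p)\<close> with the same leading
  coefficient leaves \<open>L p\<close> unchanged and lowers the degree or yields 0. Orthogonality
  to all polynomials of small degree is thereby reduced to a convenient binomial basis.\<close>

lemma linear_functional_vanishes:
  fixes L :: "'a::field poly \<Rightarrow> 'a" and B :: "nat \<Rightarrow> 'a poly"
  assumes add: "\<And>p q. L (p + q) = L p + L q" and smult: "\<And>c p. L (smult c p) = c * L p"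
    and deg: "\<And>d. d < l \<Longrightarrow> degree (B d) = d" and nz: "\<And>d. d < l \<Longrightarrow> B d \<noteq> 0"
    and zero: "\<And>d. d < l \<Longrightarrow> L (B d) = 0"
    and "degree p < l"
  shows "L p = 0"
  using \<open>degree p < l\<close>
proof (induction "degree p" arbitrary: p rule: less_induct)
  case less
  define d where "d = degree p"
  define c where "c = coeff p d / coeff (B d) d"
  define q where "q = p - smult c (B d)"
  have dl: "d < l" using less.prems by (simp add: d_def)
  have lc: "coeff (B d) d \<noteq> 0"
    using deg[OF dl] nz[OF dl] leading_coeff_neq_0 by metis
  have "L p = L q + c * L (B d)"
    using add[of q "smult c (B d)"] smult by (simp add: q_def)
  then have Lp: "L p = L q" using zero[OF dl] by simp
  have degq: "degree q \<le> d" unfolding q_def d_def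
    using deg[OF dl] by (intro degree_diff_le) (auto simp: d_def)
  have cq: "coeff q d = 0" using lc by (simp add: q_def c_def)
  show ?case
  proof (cases "q = 0")
    case True
    then show ?thesis using Lp smult[of 0 0] by simp
  next
    case False
    then have "degree q < d" using degq cq leading_coeff_neq_0 le_neq_implies_less by metis
    then show ?thesis using less.hyps[of q] dl Lp by (simp add: d_def)
  qed
qed

lemma degree_prod_linear:
  fixes a b :: "nat \<Rightarrow> 'a::field"
  assumes "finite A" "\<And>i. i \<in> A \<Longrightarrow> b i \<noteq> 0"
  shows "degree (\<Prod>i\<in>A. [:a i, b i:]) = card A"
proof -
  have "degree (\<Prod>i\<in>A. [:a i, b i:]) = (\<Sum>i\<in>A. degree [:a i, b i:])"
    by (rule degree_prod_eq_sum_degree) (use assms in auto)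
  also have "\<dots> = (\<Sum>i\<in>A. 1)" by (rule sum.cong) (use assms in auto)
  finally show ?thesis by simp
qed

text \<open>Links two views of the basis used for testing: the product form exhibits the degree
  \<open>d\<close>, the binomial form gives the values to be summed.\<close>

lemma poly_falling_factorial:
  fixes x a :: "'a::field_char_0"
  shows "poly (\<Prod>i<d. [:- a - of_nat i, 1:]) x = fact d * ((x - a) gchoose d)"
  by (simp add: poly_prod gbinomial_prod_rev atLeast0LessThan algebra_simps)

lemma poly_falling_factorial_reflected:
  fixes x a :: "'a::field_char_0"
  shows "poly (\<Prod>i<d. [:a - of_nat i, - 1:]) x = fact d * ((a - x) gchoose d)"
  by (simp add: poly_prod gbinomial_prod_rev atLeast0LessThan algebra_simps)

section \<open>Finite differences and convolutions of binomial coefficients\<close>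

text \<open>Since \<open>(l choose i) * (i choose d) = (l choose d) * ((l - d) choose (i -
  d))\<close>, what remains is the alternating sum of row \<open>l - d > 0\<close> of Pascal's
  triangle.\<close>

lemma alternating_sum_choose_mult:
  assumes "d < l"
  shows "(\<Sum>i\<le>l. (-1) ^ i * of_nat (l choose i) * of_nat (i choose d)) = (0::'a::comm_ring_1)"
proof -
  have "(\<Sum>i\<le>l. (-1) ^ i * of_nat (l choose i) * of_nat (i choose d)) =
    (\<Sum>i\<in>{d..l}. (-1) ^ i * of_nat (l choose i) * (of_nat (i choose d) :: 'a))"
    by (rule sum.mono_neutral_right) (auto simp: not_le binomial_eq_0)
  also have "\<dots> = (\<Sum>i\<le>l-d. (-1) ^ (i + d) * of_nat (l choose (i + d)) * (of_nat ((i + d) choose d) :: 'a))"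
    by (rule sum.reindex_bij_witness[where i = "\<lambda>i. i + d" and j = "\<lambda>i. i - d"]) (use assms in auto)
  also have "\<dots> = (\<Sum>i\<le>l-d. (-1) ^ d * of_nat (l choose d) * ((-1) ^ i * of_nat ((l - d) choose i)))"
  proof (rule sum.cong[OF refl])
    fix i assume "i \<in> {..l-d}"
    then have "(l choose (i + d)) * ((i + d) choose d) = (l choose d) * ((l - d) choose i)"
      using choose_mult[of d "i + d" l] assms by auto
    from arg_cong[OF this, of "of_nat :: nat \<Rightarrow> 'a"]
    show "(-1) ^ (i + d) * of_nat (l choose (i + d)) * (of_nat ((i + d) choose d) :: 'a) =
       (-1) ^ d * of_nat (l choose d) * ((-1) ^ i * of_nat ((l - d) choose i))"
      by (simp add: power_add algebra_simps)
  qed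
  also have "\<dots> = 0"
    using choose_alternating_sum[of "l - d", where 'a = 'a] assms
    by (simp flip: sum_distrib_left)
  finally show ?thesis .
qed

text \<open>Up to sign this is the \<open>l\<close>-th finite difference of \<open>p\<close> at 0;
  on the binomial basis it vanishes by the preceding lemma.\<close>

lemma alternating_sum_choose_poly:
  fixes p :: "'a::field_char_0 poly"
  assumes "degree p < l"
  shows "(\<Sum>i\<le>l. (-1) ^ i * of_nat (l choose i) * poly p (of_nat i)) = 0"
proof -
  let ?B = "\<lambda>d. \<Prod>i<d. [:- 0 - of_nat i, 1 :: 'a:]"
  have B: "poly (?B d) (of_nat i) = fact d * of_nat (i choose d)" for d i
    by (simp only: poly_falling_factorial diff_zero binomial_gbinomial)
  show ?thesis
  proof (rule linear_functional_vanishes[where B = ?B and l = l])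
    fix d assume "d < l"
    have "(\<Sum>i\<le>l. (-1) ^ i * of_nat (l choose i) * poly (?B d) (of_nat i)) =
      fact d * (\<Sum>i\<le>l. (-1) ^ i * of_nat (l choose i) * (of_nat (i choose d) :: 'a))"
      unfolding B by (simp add: sum_distrib_left algebra_simps)
    then show "(\<Sum>i\<le>l. (-1) ^ i * of_nat (l choose i) * poly (?B d) (of_nat i)) = 0"
      using alternating_sum_choose_mult[OF \<open>d < l\<close>, where 'a = 'a] by simp
  qed (use assms in \<open>auto simp: degree_prod_linear sum.distrib sum_distrib_left algebra_simps\<close>)
qed

text \<open>Sort the subsets of size \<open>i + s + 1\<close> of \<open>{..<n}\<close> by their
  element \<open>k\<close> with \<open>i\<close> elements below it and \<open>s\<close> above. The
  formal proof is an induction with Pascal's rule on the second factor.\<close>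

lemma sum_choose_convolution:
  "(\<Sum>k<n. (k choose i) * ((n - 1 - k) choose s)) = n choose (i + s + 1)"
proof (induction n arbitrary: s)
  case (Suc n)
  show ?case
  proof (cases s)
    case 0
    then show ?thesis using sum_choose_upper[of i n] by (simp add: lessThan_Suc_atMost)
  next
    case (Suc t)
    have "(\<Sum>k<Suc n. (k choose i) * ((Suc n - 1 - k) choose s)) =
      (\<Sum>k<n. (k choose i) * ((n - k) choose Suc t))"
      by (simp add: Suc)
    also have "\<dots> = (\<Sum>k<n. (k choose i) * ((n - 1 - k) choose t) + (k choose i) * ((n - 1 - k) choose s))"
    proof (rule sum.cong[OF refl])
      fix k assume "k \<in> {..<n}"
      then have "n - k = Suc (n - 1 - k)" by auto
      then have "(n - k) choose Suc t = ((n - 1 - k) choose t) + ((n - 1 - k) choose s)"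
        by (simp only: binomial_Suc_Suc Suc)
      then show "(k choose i) * ((n - k) choose Suc t) =
        (k choose i) * ((n - 1 - k) choose t) + (k choose i) * ((n - 1 - k) choose s)"
        by (simp only: distrib_left)
    qed
    finally show ?thesis using Suc.IH[of t] Suc.IH[of s] by (simp add: sum.distrib Suc)
  qed
qed simp

section \<open>Exponential lower bound for a ratio of binomial coefficients\<close>

text \<open>After taking logarithms, the difference of the two sides vanishes at 0 and has the
  nonnegative derivative \<open>2 * x\<^sup>2 / (1 - x\<^sup>2)\<close>.\<close>

lemma exp_le_symmetric_ratio:
  fixes u :: real
  assumes "0 \<le> u" "u < 1"
  shows "exp (2 * u) \<le> (1 + u) / (1 - u)"
proof -
  let ?f = "\<lambda>u::real. ln (1 + u) - ln (1 - u) - 2 * u"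
  have "?f 0 \<le> ?f u"
  proof (rule DERIV_nonneg_imp_nondecreasing[OF assms(1)])
    fix x :: real assume x: "0 \<le> x" "x \<le> u"
    have "(?f has_real_derivative (1 / (1 + x) + 1 / (1 - x) - 2)) (at x)"
      using x assms by (auto intro!: derivative_eq_intros)
    moreover have "1 / (1 + x) + 1 / (1 - x) - 2 = 2 * x\<^sup>2 / ((1 + x) * (1 - x))"
    proof -
      have "1 + x \<noteq> 0" "1 - x \<noteq> 0" using x assms by auto
      then show ?thesis by (simp add: divide_simps) (simp add: algebra_simps power2_eq_square)
    qed
    then have "0 \<le> 1 / (1 + x) + 1 / (1 - x) - 2" using x assms by simp
    ultimately show "\<exists>y. (?f has_real_derivative y) (at x) \<and> 0 \<le> y" by blast
  qed
  then have "2 * u \<le> ln ((1 + u) / (1 - u))" using assms by (simp add: ln_div)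
  then show ?thesis using assms by (subst (asm) ln_ge_iff) auto
qed

text \<open>Passing from \<open>l\<close> to \<open>l + 1\<close> multiplies the ratio by
  \<open>(N + l + 1) / (N - l)\<close>, which is at least
  \<open>exp ((2 * l + 1) / (N + 1/2))\<close>; the odd numbers add up to a square.\<close>

lemma choose_ratio_ge_exp:
  assumes "l \<le> N"
  shows "exp ((real l)\<^sup>2 / (real N + 1/2)) \<le> real ((N + l) choose l) / real (N choose l)"
  using assms
proof (induction l)
  case (Suc l)
  \<comment> \<open>\<open>M\<close> is the mean of \<open>N + l + 1\<close> and
    \<open>N - l\<close>, and \<open>l + 1/2\<close> is half their difference, so the new factor is
    \<open>(1 + u) / (1 - u)\<close>.\<close>
  define M where "M = real N + 1/2"
  define u where "u = (real l + 1/2) / M"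
  have M: "M > 0" by (simp add: M_def)
  have u: "0 \<le> u" "u < 1" using Suc.prems by (auto simp: u_def M_def field_simps)
  have "1 + u = (real N + real l + 1) / M" "1 - u = (real N - real l) / M"
    using M by (simp_all add: u_def M_def field_simps)
  then have "(1 + u) / (1 - u) = (real N + real l + 1) / (real N - real l)"
    using M by simp
  then have e: "exp (2 * u) \<le> (real N + real l + 1) / (real N - real l)"
    using exp_le_symmetric_ratio[OF u] by simp
  have "(real (Suc l))\<^sup>2 / M = (real l)\<^sup>2 / M + 2 * u"
    by (simp add: u_def power2_eq_square algebra_simps flip: add_divide_distrib)
  then have "exp ((real (Suc l))\<^sup>2 / M) = exp ((real l)\<^sup>2 / M) * exp (2 * u)"
    by (simp add: exp_add)
  also have "\<dots> \<le> real ((N + l) choose l) / real (N choose l) * ((real N + real l + 1) / (real N - real l))"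
    using Suc e by (intro mult_mono) (auto simp: M_def)
  also have "\<dots> = real ((N + Suc l) choose Suc l) / real (N choose Suc l)"
  proof -
    have "Suc l * ((N + Suc l) choose Suc l) = (N + l + 1) * ((N + l) choose l)"
      using Suc_times_binomial_eq[of "N + l" l] by (simp add: mult.commute)
    from arg_cong[OF this, of real]
    have 1: "real ((N + Suc l) choose Suc l) = (real N + real l + 1) * real ((N + l) choose l) / real (Suc l)"
      by (simp add: field_simps)
    have "Suc l * (N choose Suc l) = (N - l) * (N choose l)"
      by (metis binomial_absorb_comp binomial_absorption)
    from arg_cong[OF this, of real]
    have 2: "real (N choose Suc l) = (real N - real l) * real (N choose l) / real (Suc l)"
      using Suc.prems by (simp add: field_simps of_nat_diff)
    show ?thesis unfolding 1 2 by (simp add: mult_ac del: of_nat_Suc)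
  qed
  finally show ?case by (simp add: M_def)
qed simp

subsection \<open>The reproducing polynomial\<close>

lemma prod_add_fact:
  assumes "s < l"
  shows "(\<Prod>t\<in>{Suc s..<l}. of_nat i + of_nat t) * fact (i + s) = (fact (i + l - 1) :: 'a::{semiring_char_0,comm_semiring_1})"
proof -
  obtain m where "l = s + Suc m" using less_imp_Suc_add[OF assms] by auto
  then show ?thesis
  proof (induction m arbitrary: l)
    case (Suc m)
    have l: "{Suc s..<l} = insert (s + Suc m) {Suc s..<s + Suc m}" using Suc.prems by auto
    have "fact (i + l - 1) = (of_nat i + of_nat (s + Suc m)) * (fact (i + (s + Suc m) - 1) :: 'a)"
      using Suc.prems by (simp add: algebra_simps)
    then show ?case using Suc.IH[OF refl] unfolding l by (simp add: mult.assoc)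
  qed simp
qed

lemma choose_mult_le:
  assumes "i \<le> N"
  shows "(N choose (i + s)) * ((i + s) choose i) = (N choose i) * ((N - i) choose s)"
proof (cases "i + s \<le> N")
  case True
  then show ?thesis using choose_mult[of i "i + s" N] by simp
next
  case False
  then have "N < i + s" "N - i < s" using assms by auto
  then show ?thesis by (simp add: binomial_eq_0)
qed

text \<open>Cancelling \<open>(i + s)!\<close> turns an apparently rational expression in
  \<open>i\<close> into a product of \<open>l - 1\<close> linear factors, to which finite
  differences apply.\<close>

lemma binomial_quotient_as_prod:
  assumes "s < l" "i \<le> N"
  shows "fact (l - 1) * real (N choose (i + s)) * real ((l + i - 1) choose i) / real (N choose i) =
    (\<Prod>t\<in>{Suc s..<l}. real i + real t) * (fact s * real ((N - i) choose s))"
proof -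
  have nz: "real (N choose i) \<noteq> 0" using assms by simp
  have 1: "real ((N - i) choose s) = real (N choose (i + s)) * real ((i + s) choose i) / real (N choose i)"
    using arg_cong[OF choose_mult_le[OF assms(2), of s], of real] nz by (simp add: field_simps)
  have 2: "fact s * real ((i + s) choose i) = fact (i + s) / fact i"
    using binomial_fact[of i "i + s", where 'a = real] by simp
  have 3: "fact (l - 1) * real ((l + i - 1) choose i) = fact (i + l - 1) / fact i"
    using binomial_fact[of i "l + i - 1", where 'a = real] assms by (simp add: add.commute)
  have "(\<Prod>t\<in>{Suc s..<l}. real i + real t) * (fact s * real ((N - i) choose s)) =
    (\<Prod>t\<in>{Suc s..<l}. real i + real t) * (fact s * real ((i + s) choose i)) * real (N choose (i + s)) / real (N choose i)"
    unfolding 1 by simp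
  also have "\<dots> = ((\<Prod>t\<in>{Suc s..<l}. real i + real t) * fact (i + s)) / fact i * real (N choose (i + s)) / real (N choose i)"
    unfolding 2 by simp
  also have "\<dots> = (fact (l - 1) * real ((l + i - 1) choose i)) * real (N choose (i + s)) / real (N choose i)"
    unfolding prod_add_fact[OF assms(1)] 3 by simp
  finally show ?thesis by (simp add: mult_ac)
qed

text \<open>Up to the factor \<open>(l - 1)!\<close>, the bracket is the value at \<open>i\<close>
  of a polynomial of degree less than \<open>l\<close>, so its \<open>l\<close>-th finite difference
  vanishes. Each \<open>s\<close> yields one equation for the coefficients of the reproducing
  polynomial.\<close>

lemma alternating_sum_binomial_quotient:
  assumes "s < l" "l \<le> N"
  shows "(\<Sum>i\<le>l. (-1) ^ i * real (l choose i) *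
    (real (N choose (i + s)) * real ((l + i - 1) choose i) / real (N choose i))) = 0"
proof -
  define P :: "real poly" where
    "P = (\<Prod>t\<in>{Suc s..<l}. [:real t, 1:]) * (\<Prod>t<s. [:real N - of_nat t, -1:])"
  have "degree P \<le> (l - Suc s) + s"
    unfolding P_def by (rule order.trans[OF degree_mult_le]) (simp add: degree_prod_linear)
  then have deg: "degree P < l" using assms by simp
  have P: "poly P (of_nat i) = fact (l - 1) *
      (real (N choose (i + s)) * real ((l + i - 1) choose i) / real (N choose i))" if "i \<le> l" for i
  proof -
    have "i \<le> N" using that assms by simp
    have "poly P (of_nat i) = (\<Prod>t\<in>{Suc s..<l}. real i + real t) * (fact s * real ((N - i) choose s))"
      unfolding P_def poly_mult poly_falling_factorial_reflected
      using \<open>i \<le> N\<close> by (simp add: poly_prod binomial_gbinomial of_nat_diff add.commute)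
    then show ?thesis using binomial_quotient_as_prod[OF assms(1) \<open>i \<le> N\<close>] by simp
  qed
  have "0 = (\<Sum>i\<le>l. (-1) ^ i * real (l choose i) * poly P (of_nat i))"
    using alternating_sum_choose_poly[OF deg] by simp
  also have "\<dots> = fact (l - 1) * (\<Sum>i\<le>l. (-1) ^ i * real (l choose i) *
    (real (N choose (i + s)) * real ((l + i - 1) choose i) / real (N choose i)))"
    unfolding sum_distrib_left by (rule sum.cong) (auto simp: P mult_ac)
  finally show ?thesis by simp
qed

text \<open>Evaluates \<open>r 0 + 1\<close> for the reproducing polynomial \<open>r\<close>.
  Rewriting \<open>(l choose i) / (N choose i)\<close> over the common denominator
  \<open>N choose l\<close> makes the sum a convolution.\<close>

lemma sum_binomial_quotient:
  assumes "0 < l" "l \<le> N"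
  shows "(\<Sum>i\<le>l. real (l choose i) * real ((l + i - 1) choose i) / real (N choose i)) =
    real ((N + l) choose l) / real (N choose l)"
proof -
  have eq: "real (l choose i) / real (N choose i) = real ((N - i) choose (N - l)) / real (N choose l)"
    if "i \<le> l" for i
  proof -
    have "(N choose l) * (l choose i) = (N choose i) * ((N - i) choose (l - i))"
      using choose_mult[of i l N] that assms by simp
    also have "(N - i) choose (l - i) = (N - i) choose (N - l)"
      using binomial_symmetric[of "l - i" "N - i"] that assms by simp
    finally have "real (N choose l) * real (l choose i) = real (N choose i) * real ((N - i) choose (N - l))"
      by (metis of_nat_mult)
    then show ?thesis using that assms by (simp add: field_simps)
  qed
  have "(N + l) choose l = (N + l) choose ((l - 1) + (N - l) + 1)"
    using assms binomial_symmetric[of l "N + l"] by simp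
  also have "\<dots> = (\<Sum>k<N + l. (k choose (l - 1)) * ((N + l - 1 - k) choose (N - l)))"
    by (rule sum_choose_convolution[symmetric])
  \<comment> \<open>The first factor vanishes for \<open>k < l - 1\<close>, the second for
    \<open>k > 2 * l - 1\<close>; then put \<open>k = l + i - 1\<close>.\<close>
  also have "\<dots> = (\<Sum>k\<in>{l-1..2*l-1}. (k choose (l - 1)) * ((N + l - 1 - k) choose (N - l)))"
    by (rule sum.mono_neutral_right) (use assms in \<open>auto simp: binomial_eq_0\<close>)
  also have "\<dots> = (\<Sum>i\<le>l. ((l + i - 1) choose (l - 1)) * ((N - i) choose (N - l)))"
    by (rule sum.reindex_bij_witness[where i = "\<lambda>i. l + i - 1" and j = "\<lambda>k. k + 1 - l"]) (use assms in auto)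
  also have "\<dots> = (\<Sum>i\<le>l. ((l + i - 1) choose i) * ((N - i) choose (N - l)))"
    using assms binomial_symmetric[of "l - 1"] by (intro sum.cong) auto
  finally have "real ((N + l) choose l) = (\<Sum>i\<le>l. real ((l + i - 1) choose i) * real ((N - i) choose (N - l)))"
    by simp
  then have "real ((N + l) choose l) / real (N choose l) =
    (\<Sum>i\<le>l. real ((l + i - 1) choose i) * (real ((N - i) choose (N - l)) / real (N choose l)))"
    by (simp add: sum_divide_distrib)
  also have "\<dots> = (\<Sum>i\<le>l. real ((l + i - 1) choose i) * (real (l choose i) / real (N choose i)))"
    by (rule sum.cong) (simp_all add: eq)
  finally show ?thesis by (simp add: mult_ac)
qed

text \<open>
  The coefficients of \<open>r\<close> in the basis \<open>x - 1 choose k\<close> solve the linear system obtained by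
  testing against \<open>N - x choose s\<close>, which the preceding alternating sum makes explicit.
  Up to scaling, \<open>r\<close> is the polynomial of degree less than \<open>l\<close> with
  \<open>r 0 = 1\<close> and the least sum of squares over \<open>1, \<dots>, N\<close>.
\<close>

lemma ex_reproducing_polynomial:
  assumes "0 < l" "l \<le> N"
  obtains r :: "real poly" where "degree r < l"
    "\<And>q. degree q < l \<Longrightarrow> (\<Sum>j<N. poly r (real (Suc j)) * poly q (real (Suc j))) = poly q 0"
    "poly r 0 = real ((N + l) choose l) / real (N choose l) - 1"
proof
  define f where "f i = real (l choose i) * real ((l + i - 1) choose i) / real (N choose i)" for i
  define e where "e k = (-1) ^ k * f (Suc k)" for k
  define r where "r = (\<Sum>k<l. smult (e k / fact k) (\<Prod>i<k. [:- 1 - of_nat i, 1:]))"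
  have poly_r: "poly r x = (\<Sum>k<l. e k * ((x - 1) gchoose k))" for x
    unfolding r_def poly_sum poly_smult poly_falling_factorial by simp
  have poly_r_Suc: "poly r (real (Suc j)) = (\<Sum>k<l. e k * real (j choose k))" for j
    unfolding poly_r by (simp add: binomial_gbinomial)
  show "degree r < l"
    unfolding r_def
  proof (rule degree_sum_less)
    fix k assume "k \<in> {..<l}"
    then show "degree (smult (e k / fact k) (\<Prod>i<k. [:- 1 - of_nat i, 1:])) < l"
      by (intro le_less_trans[OF degree_smult_le]) (simp add: degree_prod_linear)
  qed (use assms in simp)
  \<comment> \<open>At 0 the basis polynomials take the values \<open>(-1) ^ k\<close>, which cancel
    the signs in \<open>e\<close>; the term \<open>f 0 = 1\<close> missing from the full sum
    accounts for the \<open>- 1\<close> in the claim.\<close>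
  have "poly r 0 = (\<Sum>k<l. f (Suc k))"
  proof -
    have "((0 - 1 :: real) gchoose k) = (-1) ^ k" for k
      using gbinomial_minus[of "1 :: real" k] by (simp flip: binomial_gbinomial)
    then show ?thesis unfolding poly_r by (simp add: e_def mult_ac)
  qed
  moreover have "(\<Sum>i\<le>l. f i) = 1 + (\<Sum>k<l. f (Suc k))"
    using assms by (subst sum.atMost_shift) (simp add: f_def)
  ultimately show "poly r 0 = real ((N + l) choose l) / real (N choose l) - 1"
    using sum_binomial_quotient[OF assms] by (simp add: f_def)
  fix q :: "real poly" assume degq: "degree q < l"
  \<comment> \<open>At the point \<open>j + 1\<close> the basis of \<open>r\<close> gives
    \<open>j choose k\<close> and this one gives \<open>(N - 1 - j) choose s\<close> up to
    \<open>s!\<close>, so summing over \<open>j\<close> is a convolution.\<close>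
  let ?B = "\<lambda>s. \<Prod>t<s. [:real N - of_nat t, -1:]"
  have "(\<Sum>j<N. poly r (real (Suc j)) * poly q (real (Suc j))) - poly q 0 = 0"
  proof (rule linear_functional_vanishes[where B = ?B and l = l])
    fix s assume "s < l"
    have B: "poly (?B s) (real (Suc j)) = fact s * real ((N - 1 - j) choose s)" if "j < N" for j
      using that unfolding poly_falling_factorial_reflected
      by (simp add: binomial_gbinomial of_nat_diff algebra_simps)
    have B0: "poly (?B s) 0 = fact s * real (N choose s)"
      unfolding poly_falling_factorial_reflected by (simp add: binomial_gbinomial)
    have "(\<Sum>j<N. poly r (real (Suc j)) * poly (?B s) (real (Suc j))) =
      (\<Sum>j<N. \<Sum>k<l. fact s * e k * real ((j choose k) * ((N - 1 - j) choose s)))"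
      by (rule sum.cong[OF refl]) (simp add: B poly_r_Suc sum_distrib_left sum_distrib_right mult_ac del: of_nat_Suc)
    also have "\<dots> = (\<Sum>k<l. fact s * e k * real (\<Sum>j<N. (j choose k) * ((N - 1 - j) choose s)))"
      by (subst sum.swap) (simp add: sum_distrib_left)
    also have "\<dots> = fact s * (\<Sum>k<l. e k * real (N choose (Suc k + s)))"
      unfolding sum_choose_convolution by (simp add: sum_distrib_left mult_ac)
    also have "(\<Sum>k<l. e k * real (N choose (Suc k + s))) = real (N choose s)"
    proof -
      \<comment> \<open>The term \<open>i = 0\<close> is \<open>N choose s\<close>, and the terms
        \<open>i = k + 1\<close> are the negatives of those wanted.\<close>
      let ?g = "\<lambda>i. (-1) ^ i * real (l choose i) *
        (real (N choose (i + s)) * real ((l + i - 1) choose i) / real (N choose i))"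
      have "0 = (\<Sum>i\<le>l. ?g i)"
        using alternating_sum_binomial_quotient[OF \<open>s < l\<close> assms(2)] by simp
      also have "\<dots> = ?g 0 + (\<Sum>k<l. ?g (Suc k))" by (rule sum.atMost_shift)
      also have "(\<Sum>k<l. ?g (Suc k)) = - (\<Sum>k<l. e k * real (N choose (Suc k + s)))"
        unfolding sum_negf[symmetric] by (rule sum.cong) (simp_all add: e_def f_def)
      finally show ?thesis by simp
    qed
    finally show "(\<Sum>j<N. poly r (real (Suc j)) * poly (?B s) (real (Suc j))) - poly (?B s) 0 = 0"
      by (simp add: B0)
  next
    fix d
    show "degree (?B d) = d" by (simp add: degree_prod_linear)
    show "?B d \<noteq> 0" by simp
  qed (use degq in \<open>simp_all add: sum.distrib sum_distrib_left algebra_simps\<close>)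
  then show "(\<Sum>j<N. poly r (real (Suc j)) * poly q (real (Suc j))) = poly q 0" by simp
qed

text \<open>Let \<open>R = r 0\<close> for the reproducing polynomial \<open>r\<close>. Reproducing
  \<open>r\<close> itself shows that its squares over \<open>1, ..., N\<close> sum to
  \<open>R\<close>; orthogonality of \<open>b\<close> to \<open>r\<close> and Cauchy-Schwarz give
  \<open>(b 0 * R)\<^sup>2 \<le> S * R\<close>, and \<open>R\<close> cancels.\<close>

lemma first_entry_bound:
  fixes b :: "nat \<Rightarrow> real"
  assumes "0 < l" "l \<le> N"
    and orth: "\<And>p. degree p < l \<Longrightarrow> (\<Sum>j\<le>N. b j * poly p (real j)) = 0"
  shows "(b 0)\<^sup>2 * (real ((N + l) choose l) / real (N choose l) - 1) \<le> (\<Sum>j<N. (b (Suc j))\<^sup>2)"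
proof -
  obtain r :: "real poly" where r: "degree r < l"
    "\<And>q. degree q < l \<Longrightarrow> (\<Sum>j<N. poly r (real (Suc j)) * poly q (real (Suc j))) = poly q 0"
    "poly r 0 = real ((N + l) choose l) / real (N choose l) - 1"
    using ex_reproducing_polynomial[OF assms(1,2)] by metis
  define R where "R = poly r 0"
  define S where "S = (\<Sum>j<N. (b (Suc j))\<^sup>2)"
  have R: "(\<Sum>j<N. (poly r (real (Suc j)))\<^sup>2) = R"
    using r(2)[OF r(1)] by (simp add: power2_eq_square R_def)
  have S0: "S \<ge> 0" and R0: "R \<ge> 0" unfolding S_def R[symmetric] by (auto intro: sum_nonneg)
  have "b 0 * R = - (\<Sum>j<N. b (Suc j) * poly r (real (Suc j)))"
    using orth[OF r(1)] by (subst (asm) sum.atMost_shift) (simp add: R_def)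
  then have "(b 0 * R)\<^sup>2 \<le> S * R"
    using Cauchy_Schwarz_ineq_sum[of "\<lambda>j. b (Suc j)" "\<lambda>j. poly r (real (Suc j))" "{..<N}"]
    unfolding S_def R by simp
  then have "R * ((b 0)\<^sup>2 * R) \<le> R * S" by (simp add: power2_eq_square mult_ac)
  then have "(b 0)\<^sup>2 * R \<le> S" using S0 R0 by (cases "R = 0") auto
  then show ?thesis by (simp add: R_def S_def r(3))
qed

subsection \<open>Multisets with equal binomial moments\<close>

lemma sum_mset_eq_sum_count:
  fixes f :: "'a \<Rightarrow> 'b::semiring_1"
  assumes "finite A" "set_mset M \<subseteq> A"
  shows "(\<Sum>x\<in>#M. f x) = (\<Sum>x\<in>A. of_nat (count M x) * f x)"
  using assms(2)
proof (induction M)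
  case (add y M)
  have "(\<Sum>x\<in>A. of_nat (count (add_mset y M) x) * f x) =
    (\<Sum>x\<in>A. of_nat (count M x) * f x + (if x = y then f x else 0))"
    by (rule sum.cong) (auto simp: algebra_simps)
  then show ?case using add assms(1) by (simp add: sum.distrib add.commute)
qed simp

theorem multiset_eq_if_binomial_moments_eq:
  fixes M M' :: "nat multiset"
  assumes n: "0 < n" and l: "sqrt (2 * real n * ln (2 * real n)) \<le> real l"
    and M: "size M = n" "set_mset M \<subseteq> {..<n}" and M': "size M' = n" "set_mset M' \<subseteq> {..<n}"
    and moments: "\<And>s. s < l \<Longrightarrow> (\<Sum>x\<in>#M. x choose s) = (\<Sum>x\<in>#M'. x choose s)"
  shows "M = M'"
proof (rule ccontr)
  assume "M \<noteq> M'"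
  define b where "b j = real (count M j) - real (count M' j)" for j
  have b_outside: "b j = 0" if "j \<ge> n" for j
  proof -
    have "j \<notin># M" "j \<notin># M'" using that M(2) M'(2) by auto
    then show ?thesis by (simp add: b_def not_in_iff)
  qed
  have abs_b: "\<bar>b j\<bar> \<le> real (count M j) + real (count M' j)" for j by (simp add: b_def)
  have size_M: "(\<Sum>j<n. real (count M j)) = real n" "(\<Sum>j<n. real (count M' j)) = real n"
    using sum_mset_eq_sum_count[of "{..<n}" M "\<lambda>_. 1::real"] M
      sum_mset_eq_sum_count[of "{..<n}" M' "\<lambda>_. 1::real"] M' by simp_all
  have b_le: "\<bar>b j\<bar> \<le> real n" for j
  proof -
    have "real (count M j) \<le> real n" "real (count M' j) \<le> real n"
      using count_le_size[of M j] count_le_size[of M' j] M M' by simp_all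
    then show ?thesis by (simp add: b_def abs_le_iff)
  qed
  \<comment> \<open>The first nonzero entry is moved to 0, where \<open>first_entry_bound\<close>
    applies. The window \<open>{j0..j0+N}\<close> reaches past \<open>n - 1\<close> only into
    zeros.\<close>
  define j0 where "j0 = (LEAST j. b j \<noteq> 0)"
  have "\<exists>j. b j \<noteq> 0" using \<open>M \<noteq> M'\<close> by (auto simp: b_def multiset_eq_iff)
  then have j0: "b j0 \<noteq> 0" unfolding j0_def by (rule LeastI_ex)
  have below: "b j = 0" if "j < j0" for j using not_less_Least[of j "\<lambda>j. b j \<noteq> 0"] that by (auto simp: j0_def)
  have "j0 < n" using b_outside[of j0] j0 by force
  define N where "N = n - 1"
  define c where "c j = b (j0 + j)" for j
  have shift: "(\<Sum>j\<le>N. f (j0 + j)) = (\<Sum>j<n. f j)"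
    if "\<And>j. j < j0 \<or> j \<ge> n \<Longrightarrow> f j = 0" for f :: "nat \<Rightarrow> real"
  proof -
    have "(\<Sum>j\<le>N. f (j0 + j)) = (\<Sum>j\<in>{j0..j0+N}. f j)"
      by (rule sum.reindex_bij_witness[where i = "\<lambda>j. j - j0" and j = "\<lambda>j. j0 + j"]) auto
    also have "\<dots> = (\<Sum>j\<in>{j0..<n}. f j)"
      by (rule sum.mono_neutral_right) (use that n in \<open>auto simp: N_def\<close>)
    also have "\<dots> = (\<Sum>j<n. f j)"
      by (rule sum.mono_neutral_left) (use that in auto)
    finally show ?thesis .
  qed
  have orth_b: "(\<Sum>j<n. b j * poly p (real j)) = 0" if "degree p < l" for p
  proof (rule linear_functional_vanishes[where l = l and
        L = "\<lambda>p. \<Sum>j<n. b j * poly p (real j)" and B = "\<lambda>d. \<Prod>i<d. [:- 0 - of_nat i, 1:]"])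
    fix d assume "d < l"
    have "real (\<Sum>x\<in>#M. x choose d) = real (\<Sum>x\<in>#M'. x choose d)" using moments[OF \<open>d < l\<close>] by simp
    then have "(\<Sum>j<n. b j * real (j choose d)) = 0"
      using sum_mset_eq_sum_count[of "{..<n}" M "\<lambda>j. j choose d"] M
        sum_mset_eq_sum_count[of "{..<n}" M' "\<lambda>j. j choose d"] M'
      by (simp add: b_def left_diff_distrib sum_subtractf)
    then have "fact d * (\<Sum>j<n. b j * real (j choose d)) = 0" by simp
    moreover have "(\<Sum>j<n. b j * poly (\<Prod>i<d. [:- 0 - of_nat i, 1:]) (real j)) =
        fact d * (\<Sum>j<n. b j * real (j choose d))"
      unfolding poly_falling_factorial sum_distrib_left
      by (rule sum.cong) (simp_all add: binomial_gbinomial)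
    ultimately show "(\<Sum>j<n. b j * poly (\<Prod>i<d. [:- 0 - of_nat i, 1:]) (real j)) = 0" by simp
  qed (use that in \<open>auto simp: degree_prod_linear sum.distrib sum_distrib_left algebra_simps\<close>)
  have orth: "(\<Sum>j\<le>N. c j * poly p (real j)) = 0" if "degree p < l" for p
  proof -
    define q where "q = pcompose p [:- real j0, 1:]"
    have "degree q < l" using that by (simp add: q_def degree_pcompose)
    then have "(\<Sum>j<n. b j * poly q (real j)) = 0" by (rule orth_b)
    moreover have "(\<Sum>j\<le>N. b (j0 + j) * poly q (real (j0 + j))) = (\<Sum>j<n. b j * poly q (real j))"
      by (rule shift) (use below b_outside in auto)
    moreover have "poly q (real (j0 + j)) = poly p (real j)" for j
      by (simp add: q_def poly_pcompose)
    ultimately show ?thesis by (simp add: c_def)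
  qed
  have "ln (2 * real n) > 0" using n by simp
  then have "sqrt (2 * real n * ln (2 * real n)) > 0" using n by simp
  then have "0 < l" using l by linarith
  show False
  proof (cases "l \<le> N")
    \<comment> \<open>The reproducing polynomial requires \<open>l \<le> N\<close>. Here instead the
      degree \<open>N\<close> of the polynomial with roots \<open>1, ..., N\<close> is below
      \<open>l\<close>, and its value at 0 is nonzero.\<close>
    case False
    define p :: "real poly" where "p = (\<Prod>i<N. [:- real (Suc i), 1:])"
    have "degree p < l" using False by (simp add: p_def degree_prod_linear)
    then have "0 = (\<Sum>j\<le>N. c j * poly p (real j))" using orth by simp
    also have "\<dots> = c 0 * poly p 0"
    proof -
      have "poly p (real (Suc j)) = 0" if "j < N" for j
        using that by (auto simp: p_def poly_prod simp del: of_nat_Suc)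
      then show ?thesis by (subst sum.atMost_shift) (simp del: of_nat_Suc)
    qed
    finally have "poly p 0 = 0" using j0 by (simp add: c_def)
    then show False by (auto simp: p_def poly_prod simp del: of_nat_Suc)
  next
    case True
    define R where "R = real ((N + l) choose l) / real (N choose l)"
    have "2 * real n * ln (2 * real n) \<le> (real l)\<^sup>2" using l by (rule sqrt_le_D)
    \<comment> \<open>As \<open>N + 1/2 = n - 1/2 \<le> n\<close>, the hypothesis on
      \<open>l\<close> makes the exponent at least \<open>2 * ln (2 * n)\<close>, hence
      \<open>R \<ge> (2 * n)\<^sup>2\<close>.\<close>
    moreover have "2 * ln (2 * real n) * (real N + 1/2) \<le> 2 * real n * ln (2 * real n)"
      using n \<open>ln (2 * real n) > 0\<close> by (simp add: N_def of_nat_diff algebra_simps)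
    ultimately have "2 * ln (2 * real n) \<le> (real l)\<^sup>2 / (real N + 1/2)"
      by (subst pos_le_divide_eq) auto
    then have "exp (2 * ln (2 * real n)) \<le> R"
      using choose_ratio_ge_exp[OF True] unfolding R_def by (meson exp_le_cancel_iff order_trans)
    moreover have "exp (2 * ln (2 * real n)) = 4 * (real n)\<^sup>2"
      using n by (subst exp_double) (simp add: power_mult_distrib)
    ultimately have R: "4 * (real n)\<^sup>2 \<le> R" by simp
    have "(1::real) \<le> (b j0)\<^sup>2"
    proof -
      have "b j0 = real_of_int (int (count M j0) - int (count M' j0))" by (simp add: b_def)
      moreover from this have "int (count M j0) - int (count M' j0) \<noteq> 0" using j0 by auto
      ultimately have "1 \<le> \<bar>b j0\<bar>" by linarith
      then show ?thesis using one_le_power[of "\<bar>b j0\<bar>" 2] by simp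
    qed
    moreover have n2: "1 \<le> (real n)\<^sup>2" using n by simp
    then have "1 \<le> 4 * (real n)\<^sup>2" by linarith
    ultimately have "4 * (real n)\<^sup>2 - 1 \<le> (c 0)\<^sup>2 * (R - 1)"
      using R mult_mono[of 1 "(c 0)\<^sup>2" "4 * (real n)\<^sup>2 - 1" "R - 1"] by (simp add: c_def)
    also have "\<dots> \<le> (\<Sum>j<N. (c (Suc j))\<^sup>2)"
      using first_entry_bound[OF \<open>0 < l\<close> True orth] by (simp add: R_def)
    also have "\<dots> \<le> (\<Sum>j\<le>N. (c j)\<^sup>2)"
      by (subst sum.atMost_shift) simp
    also have "\<dots> = (\<Sum>j<n. (b j)\<^sup>2)"
      unfolding c_def by (rule shift[where f = "\<lambda>j. (b j)\<^sup>2"]) (use below b_outside in auto)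
    \<comment> \<open>One factor \<open>\<bar>b j\<bar>\<close> is bounded by \<open>n\<close>, the
      other by the two multiplicities, which total \<open>2 * n\<close>.\<close>
    also have "\<dots> \<le> (\<Sum>j<n. real n * (real (count M j) + real (count M' j)))"
    proof (rule sum_mono)
      fix j
      have "\<bar>b j\<bar> * \<bar>b j\<bar> \<le> real n * (real (count M j) + real (count M' j))"
        using b_le[of j] abs_b[of j] by (intro mult_mono) auto
      then show "(b j)\<^sup>2 \<le> real n * (real (count M j) + real (count M' j))"
        by (simp add: power2_eq_square flip: abs_mult)
    qed
    also have "\<dots> = 2 * (real n)\<^sup>2"
      by (simp add: sum.distrib size_M power2_eq_square flip: sum_distrib_left)
    finally have "2 * (real n)\<^sup>2 \<le> 1" by simp
    then show False using n2 by simp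
  qed
qed

subsection \<open>Decks\<close>

text \<open>Removing \<open>T\<close> is a bijection onto the subsets of \<open>V - T\<close> with
  \<open>l - card T\<close> elements.\<close>

lemma card_supersets:
  assumes "finite V" "T \<subseteq> V" "card T \<le> l"
  shows "card {S. S \<subseteq> V \<and> card S = l \<and> T \<subseteq> S} = (card V - card T) choose (l - card T)"
proof -
  have fin: "finite T" using assms finite_subset by blast
  have "bij_betw (\<lambda>U. U \<union> T) {U. U \<subseteq> V - T \<and> card U = l - card T} {S. S \<subseteq> V \<and> card S = l \<and> T \<subseteq> S}"
  proof (rule bij_betw_byWitness[where f' = "\<lambda>S. S - T"])
    show "(\<lambda>U. U \<union> T) ` {U. U \<subseteq> V - T \<and> card U = l - card T} \<subseteq> {S. S \<subseteq> V \<and> card S = l \<and> T \<subseteq> S}"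
    proof (clarsimp, intro conjI)
      fix U assume U: "U \<subseteq> V - T" "card U = l - card T"
      then have "finite U" using assms finite_subset by blast
      then have "card (U \<union> T) = card U + card T" using U fin by (intro card_Un_disjoint) auto
      then show "card (U \<union> T) = l" using U assms by simp
    qed (use assms in auto)
  qed (use fin in \<open>auto simp: card_Diff_subset\<close>)
  then have "card {S. S \<subseteq> V \<and> card S = l \<and> T \<subseteq> S} = card {U. U \<subseteq> V - T \<and> card U = l - card T}"
    by (simp add: bij_betw_same_card)
  then show ?thesis using assms fin by (simp add: n_subsets card_Diff_subset)
qed

section \<open>Binomial degree moments of graphs, classes and decks\<close>

text \<open>For a \<open>pair_graph\<close> this counts stars with \<open>s\<close> leaves and a
  marked centre.\<close>

definition degree_moment :: "nat \<Rightarrow> ('a, 'b) pre_digraph \<Rightarrow> nat" where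
  "degree_moment s G = (\<Sum>v\<in>verts G. out_degree G v choose s)"

lemma degree_moment_cong_iso:
  assumes "digraph_iso G H"
  shows "degree_moment s G = degree_moment s H"
proof -
  from assms obtain h where h: "pre_digraph.digraph_isomorphism G h" "H = app_iso h G"
    by (auto simp: digraph_iso_def)
  then have "wf_digraph G" and inj: "inj_on (iso_verts h) (verts G)"
    by (simp_all add: pre_digraph.digraph_isomorphism_def)
  have "verts H = iso_verts h ` verts G" by (simp add: h(2))
  then show ?thesis
    unfolding degree_moment_def
    using wf_digraph.out_degree_app_iso_eq[OF \<open>wf_digraph G\<close> h(1)] by (simp add: sum.reindex[OF inj] h(2))
qed

text \<open>Cards are known only up to isomorphism, so the moment is read off a chosen
  representative; by \<open>degree_moment_cong_iso\<close> its value does not depend on the choice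
  for classes of graphs.\<close>

definition class_moment :: "nat \<Rightarrow> nat pair_pre_digraph set \<Rightarrow> nat" where
  "class_moment s C = degree_moment s (with_proj (SOME H. H \<in> C))"

lemma class_moment_iso_class:
  assumes "pair_graph G"
  shows "class_moment s (iso_class (with_proj G)) = degree_moment s (with_proj G)"
proof -
  have "\<exists>H. H \<in> iso_class (with_proj G)"
    using ex_nat_copy[OF assms] by (auto simp: iso_class_def)
  then have "(SOME H. H \<in> iso_class (with_proj G)) \<in> iso_class (with_proj G)" by (rule someI_ex)
  then show ?thesis
    unfolding class_moment_def by (intro degree_moment_cong_iso[symmetric]) (simp add: iso_class_def)
qed

context pair_graph
begin

lemma out_degree_eq_card_nbrs: "out_degree (with_proj G) v = card {w. (v, w) \<in> parcs G}"
proof -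
  have "out_arcs (with_proj G) v = Pair v ` {w. (v, w) \<in> parcs G}"
    by (auto simp: out_arcs_def)
  then show ?thesis by (simp add: out_degree_def card_image inj_on_def)
qed

lemma out_degree_induce_subgraph:
  assumes "v \<in> S"
  shows "out_degree (with_proj G \<restriction> S) v = card ({w. (v, w) \<in> parcs G} \<inter> S)"
proof -
  have "out_arcs (with_proj G \<restriction> S) v = Pair v ` ({w. (v, w) \<in> parcs G} \<inter> S)"
    using assms by (auto simp: out_arcs_def induce_subgraph_def)
  then show ?thesis by (simp add: out_degree_def card_image inj_on_def)
qed

lemma out_degree_less:
  assumes "v \<in> pverts G"
  shows "out_degree (with_proj G) v < card (pverts G)"
  unfolding out_degree_eq_card_nbrs
proof (rule psubset_card_mono)
  have "{w. (v, w) \<in> parcs G} \<subseteq> pverts G - {v}"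
    using pair_no_loops[of "(v, v)"] in_arcsD2 by auto
  then show "{w. (v, w) \<in> parcs G} \<subset> pverts G" using assms by auto
qed (rule pair_finite_verts)

text \<open>A vertex with \<open>s\<close> chosen neighbours occupies \<open>s + 1\<close> vertices,
  so every such pair lies in the same number of \<open>l\<close>-sets.\<close>

lemma sum_degree_moment_induced:
  assumes "s < l"
  shows "(\<Sum>S | S \<subseteq> pverts G \<and> card S = l. degree_moment s (with_proj G \<restriction> S)) =
    ((card (pverts G) - Suc s) choose (l - Suc s)) * degree_moment s (with_proj G)"
proof -
  define V where "V = pverts G"
  define nb where "nb v = {w. (v, w) \<in> parcs G}" for v
  define D where "D = {S. S \<subseteq> V \<and> card S = l}"
  define P where "P = (SIGMA v:V. {A. A \<subseteq> nb v \<and> card A = s})"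
  have finV: "finite V" unfolding V_def by (rule pair_finite_verts)
  have nbV: "nb v \<subseteq> V" for v using in_arcsD2 by (auto simp: nb_def V_def)
  then have finnb: "finite (nb v)" for v using finV finite_subset by blast
  have v_nb: "v \<notin> nb v" for v using pair_no_loops[of "(v, v)"] by (auto simp: nb_def)
  have finD: "finite D" using finV by (simp add: D_def)
  have finP: "finite P" unfolding P_def using finV finnb by (intro finite_SigmaI) auto
  have card_P: "card P = degree_moment s (with_proj G)"
    unfolding P_def degree_moment_def
    using finV finnb by (subst card_SigmaI) (auto simp: n_subsets out_degree_eq_card_nbrs nb_def V_def)
  \<comment> \<open>The neighbours of \<open>v\<close> inside the card are
    \<open>nb v \<inter> S\<close>, so the moment of the card counts the pairs of \<open>P\<close>
    that fit into \<open>S\<close>.\<close>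
  have mom: "degree_moment s (with_proj G \<restriction> S) = card {(v, A) \<in> P. insert v A \<subseteq> S}" if "S \<in> D" for S
  proof -
    have "{(v, A) \<in> P. insert v A \<subseteq> S} = (SIGMA v:S. {A. A \<subseteq> nb v \<inter> S \<and> card A = s})"
      using that by (auto simp: P_def D_def)
    moreover have "card {A. A \<subseteq> nb v \<inter> S \<and> card A = s} = card (nb v \<inter> S) choose s" for v
      using finnb by (intro n_subsets) simp
    moreover have "finite S" using that finV finite_subset by (auto simp: D_def)
    ultimately have "card {(v, A) \<in> P. insert v A \<subseteq> S} = (\<Sum>v\<in>S. card (nb v \<inter> S) choose s)"
      using finnb by (simp add: card_SigmaI del: insert_subset Int_subset_iff le_inf_iff)
    then show ?thesis
      by (simp add: degree_moment_def nb_def out_degree_induce_subgraph)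
  qed
  have "(\<Sum>S\<in>D. degree_moment s (with_proj G \<restriction> S)) = (\<Sum>S\<in>D. card {(v, A) \<in> P. insert v A \<subseteq> S})"
    by (rule sum.cong) (simp_all add: mom)
  also have "\<dots> = (\<Sum>S\<in>D. \<Sum>(v, A)\<in>P. if insert v A \<subseteq> S then 1 else 0)"
    using finP by (simp add: case_prod_unfold flip: sum.inter_filter)
  also have "\<dots> = (\<Sum>(v, A)\<in>P. \<Sum>S\<in>D. if insert v A \<subseteq> S then 1 else 0)"
    by (subst sum.swap) (simp add: case_prod_unfold)
  also have "\<dots> = (\<Sum>(v, A)\<in>P. (card V - Suc s) choose (l - Suc s))"
  proof (rule sum.cong[OF refl], clarify)
    fix v A assume "(v, A) \<in> P"
    then have A: "A \<subseteq> nb v" "card A = s" and v: "v \<in> V" by (auto simp: P_def)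
    have "finite A" using A finnb finite_subset by blast
    then have T: "card (insert v A) = Suc s" using A v_nb[of v] by (auto simp: card_insert_if)
    have "(\<Sum>S\<in>D. if insert v A \<subseteq> S then 1 else 0) = card {S. S \<subseteq> V \<and> card S = l \<and> insert v A \<subseteq> S}"
      using finD by (simp add: D_def conj_assoc flip: sum.inter_filter)
    also have "\<dots> = (card V - card (insert v A)) choose (l - card (insert v A))"
      using finV A v nbV[of v] T assms by (intro card_supersets) auto
    finally show "(\<Sum>S\<in>D. if insert v A \<subseteq> S then 1 else 0) = (card V - Suc s) choose (l - Suc s)"
      by (simp add: T)
  qed
  also have "\<dots> = ((card V - Suc s) choose (l - Suc s)) * card P" by (simp add: case_prod_unfold)
  finally show ?thesis by (simp add: card_P D_def V_def)
qed

end

text \<open>The left side is a function of the deck alone, so decks carry the moments whenever the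
  binomial factor is nonzero.\<close>

lemma sum_class_moment_deck:
  assumes "pair_graph G" "s < l"
  shows "(\<Sum>C\<in>#deck l G. class_moment s C) =
    ((card (pverts G) - Suc s) choose (l - Suc s)) * degree_moment s (with_proj G)"
proof -
  have "(\<Sum>C\<in>#deck l G. class_moment s C) =
    (\<Sum>S | S \<subseteq> pverts G \<and> card S = l. class_moment s (iso_class (with_proj G \<restriction> S)))"
    by (simp add: deck_def sum_unfold_sum_mset image_mset.compositionality comp_def)
  also have "\<dots> = (\<Sum>S | S \<subseteq> pverts G \<and> card S = l. degree_moment s (with_proj G \<restriction> S))"
  proof (rule sum.cong[OF refl], clarify)
    fix S assume "S \<subseteq> pverts G"
    then obtain H where "pair_graph H" "with_proj G \<restriction> S = with_proj H"
      using induced_subgraph_pair_graph[OF assms(1)] by blast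
    then show "class_moment s (iso_class (with_proj G \<restriction> S)) = degree_moment s (with_proj G \<restriction> S)"
      using class_moment_iso_class by metis
  qed
  finally show ?thesis using pair_graph.sum_degree_moment_induced[OF assms] by simp
qed

lemma degree_moment_eq_sum_mset:
  "degree_moment s (with_proj G) = (\<Sum>x\<in>#degree_sequence G. x choose s)"
  by (simp add: degree_moment_def degree_sequence_def sum_unfold_sum_mset image_mset.compositionality comp_def)

lemma set_degree_sequence_subset:
  assumes "pair_graph G"
  shows "set_mset (degree_sequence G) \<subseteq> {..<card (pverts G)}"
proof -
  interpret pair_graph G by fact
  show ?thesis using out_degree_less by (auto simp: degree_sequence_def)
qed

theorem theorem1p7:
  fixes n l :: nat
    and G :: "'a pair_pre_digraph" and G' :: "'b pair_pre_digraph"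
  assumes "n \<ge> 3"
    and "sqrt (2 * real n * ln (2 * real n)) \<le> real l" and "l \<le> n"
    and "pair_graph G" and "card (pverts G) = n"
    and "pair_graph G'" and "card (pverts G') = n"
    and "deck l G = deck l G'"
  shows "degree_sequence G = degree_sequence G'"
proof (rule multiset_eq_if_binomial_moments_eq)
  show "0 < n" using assms(1) by simp
  show "size (degree_sequence G) = n" "size (degree_sequence G') = n"
    using assms by (simp_all add: degree_sequence_def)
  show "set_mset (degree_sequence G) \<subseteq> {..<n}" "set_mset (degree_sequence G') \<subseteq> {..<n}"
    using set_degree_sequence_subset[OF assms(4)] set_degree_sequence_subset[OF assms(6)] assms by simp_all
  fix s assume "s < l"
  \<comment> \<open>Here \<open>l \<le> n\<close> enters: the common factor of the two deck sums is
    positive and can be cancelled.\<close>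
  then have "0 < (n - Suc s) choose (l - Suc s)" using assms(3) by simp
  then show "(\<Sum>x\<in>#degree_sequence G. x choose s) = (\<Sum>x\<in>#degree_sequence G'. x choose s)"
    using sum_class_moment_deck[OF assms(4) \<open>s < l\<close>] sum_class_moment_deck[OF assms(6) \<open>s < l\<close>] assms
    by (simp add: degree_moment_eq_sum_mset)
qed (fact assms(2))

end
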